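(* Let $m,p$ be real numbers and $\alpha,\beta$ integers, and let $\{a_n\}_{n\ge0}$, $\{b_n\}_{n\ge0}$ be sequences of real (or complex) numbers such that for all $n=0,1,2,\ldots$, $$\sum_{k=0}^n\binom{n-m}{k}(-1)^{n-k}a_{n-k}=(-1)^\alpha a_n\quad\text{and}\quad\sum_{k=0}^n\binom{n-p}{k}(-1)^{n-k}b_{n-k}=(-1)^\beta b_n.$$ If $n$ is a nonnegative integer such that $\alpha+\beta+n$ is odd, then $$\sum_{k=0}^n\frac{\binom{n-m}{k}\binom{n-p}{n-k}}{\binom nk}(-1)^ka_{n-k}b_k=0.$$
   Context: For real $x$ and a nonnegative integer $k$, $\binom xk=x(x-1)\cdots(x-k+1)/k!$ (with $\binom x0=1$). *)

theory Defs imports Complex_Main begin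

end

theory Submission imports Defs begin

text \<open>
  Weight the sequences by falling factorials, \<open>u\<^sub>j = (n - m)\<cdots>(j + 1 - m) a\<^sub>j\<close> for \<open>j \<le> n\<close>
  and likewise \<open>v\<^sub>j\<close> from \<open>p\<close> and \<open>b\<close>. The parameters \<open>m\<close> and \<open>p\<close> then disappear: the generating
  polynomials satisfy \<open>\<epsilon> U(x) = e\<^sup>x U(-x)\<close> and \<open>\<delta> V(x) = e\<^sup>x V(-x)\<close> modulo \<open>x^(n+1)\<close>, with
  signs \<open>\<epsilon>, \<delta>\<close>, and \<open>n!\<close> times the sum in question is the coefficient \<open>T\<close> of \<open>x^n\<close> in
  \<open>U(x) V(-x)\<close>. The exponentials cancel in \<open>U(-x) V(x) = \<epsilon> \<delta> U(x) V(-x)\<close>, so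
  \<open>(-1)^n T = \<epsilon> \<delta> T\<close>, which forces \<open>T = 0\<close> when \<open>\<epsilon> \<delta> (-1)^n = -1\<close>.
\<close>

text \<open>With \<open>i = n - k\<close> the constraint \<open>j \<le> k \<le> n\<close> becomes
  \<open>i + j \<le> n\<close>, so for fixed \<open>j\<close> the index \<open>i\<close> fills the
  range of a relation at \<open>n - j\<close>.\<close>

lemma sum_triangle_swap:
  fixes f :: "nat \<Rightarrow> nat \<Rightarrow> 'a :: comm_monoid_add"
  shows "(\<Sum>k\<le>n. \<Sum>j\<le>k. f k j) = (\<Sum>j\<le>n. \<Sum>i\<le>n - j. f (n - i) j)"
proof -
  have "(\<Sum>k\<le>n. \<Sum>j\<le>k. f k j) = (\<Sum>(k, j)\<in>(SIGMA k:{..n}. {..k}). f k j)"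
    by (simp add: sum.Sigma)
  also have "\<dots> = (\<Sum>(j, i)\<in>(SIGMA j:{..n}. {..n - j}). f (n - i) j)"
    by (rule sum.reindex_bij_witness[of _ "\<lambda>(j, i). (n - i, j)" "\<lambda>(k, j). (j, n - k)"]) auto
  also have "\<dots> = (\<Sum>j\<le>n. \<Sum>i\<le>n - j. f (n - i) j)"
    by (simp add: sum.Sigma)
  finally show ?thesis .
qed

text \<open>Expanding \<open>\<delta> * v k\<close> and swapping the sums leaves, for each
  \<open>j\<close>, an inner sum that is the relation for \<open>u\<close> at \<open>n - j\<close>.
  This cancels the exponentials coefficientwise.\<close>

lemma alternating_convolution_symmetry:
  fixes u v :: "nat \<Rightarrow> 'a :: field_char_0"
  assumes u: "\<And>N. N \<le> n \<Longrightarrow> (\<Sum>j\<le>N. (- 1) ^ j * u j / fact (N - j)) = \<epsilon> * u N"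
    and v: "\<And>N. N \<le> n \<Longrightarrow> (\<Sum>j\<le>N. (- 1) ^ j * v j / fact (N - j)) = \<delta> * v N"
  shows "\<delta> * (\<Sum>k\<le>n. (- 1) ^ k * u (n - k) * v k)
       = (- 1) ^ n * \<epsilon> * (\<Sum>k\<le>n. (- 1) ^ k * u (n - k) * v k)"
proof -
  have "\<delta> * (\<Sum>k\<le>n. (- 1) ^ k * u (n - k) * v k)
      = (\<Sum>k\<le>n. (- 1) ^ k * u (n - k) * (\<delta> * v k))"
    by (simp add: sum_distrib_left mult_ac)
  also have "\<dots> = (\<Sum>k\<le>n. (- 1) ^ k * u (n - k) * (\<Sum>j\<le>k. (- 1) ^ j * v j / fact (k - j)))"
    by (simp add: v)
  also have "\<dots> = (\<Sum>k\<le>n. \<Sum>j\<le>k. (- 1) ^ (k + j) * u (n - k) * v j / fact (k - j))"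
    by (simp add: sum_distrib_left power_add mult_ac)
  also have "\<dots> = (\<Sum>j\<le>n. \<Sum>i\<le>n - j. (- 1) ^ (n - i + j) * u (n - (n - i)) * v j / fact (n - i - j))"
    by (rule sum_triangle_swap)
  also have "\<dots> = (\<Sum>j\<le>n. (- 1) ^ (n - j) * v j * (\<Sum>i\<le>n - j. (- 1) ^ i * u i / fact (n - j - i)))"
    unfolding sum_distrib_left
  proof (intro sum.cong refl)
    fix i j assume ij: "j \<in> {..n}" "i \<in> {..n - j}"
    \<comment> \<open>The exponents \<open>n - i + j\<close> and \<open>n - j + i\<close> differ by
      \<open>2 * (i - j)\<close>; as \<open>i + j \<le> n\<close>, no subtraction from
      \<open>n\<close> truncates.\<close>
    then have "(- 1 :: 'a) ^ (n - i + j) = (- 1) ^ (n - j) * (- 1) ^ i"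
      by (auto simp: power_add[symmetric] minus_one_power_iff)
    moreover from ij have "n - (n - i) = i" "n - i - j = n - j - i" by auto
    ultimately show "(- 1) ^ (n - i + j) * u (n - (n - i)) * v j / fact (n - i - j)
        = (- 1) ^ (n - j) * v j * ((- 1) ^ i * u i / fact (n - j - i))"
      by (simp add: mult_ac)
  qed
  also have "\<dots> = (\<Sum>j\<le>n. (- 1) ^ (n - j) * v j * (\<epsilon> * u (n - j)))"
    \<comment> \<open>The form \<open>n - j - i\<close> must survive to match \<open>u\<close> at
      \<open>N = n - j\<close>.\<close>
    by (simp add: u del: diff_diff_left)
  also have "\<dots> = (- 1) ^ n * \<epsilon> * (\<Sum>k\<le>n. (- 1) ^ k * u (n - k) * v k)"
    unfolding sum_distrib_left
    by (intro sum.cong refl) (auto simp: minus_one_power_iff)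
  finally show ?thesis .
qed

text \<open>The falling factorial of \<open>x\<close> with \<open>i\<close> factors is continued by
  the next \<open>k - i\<close> factors, which start at \<open>x - i\<close>.\<close>

lemma fact_gbinomial_mult_gbinomial:
  fixes x :: "'a :: field_char_0"
  assumes "i \<le> k"
  shows "fact i * (x gchoose i) * ((x - of_nat i) gchoose (k - i)) = fact k * (x gchoose k) / fact (k - i)"
proof -
  have "fact i * (x gchoose i) * ((x - of_nat i) gchoose (k - i))
      = fact i * ((x gchoose k) * of_nat (k choose i))"
    using gbinomial_trinomial_revision[OF assms, of x] by (simp add: binomial_gbinomial)
  also have "\<dots> = fact k * (x gchoose k) / fact (k - i)"
    using assms by (simp add: binomial_fact)
  finally show ?thesis .
qed

text \<open>The weight at \<open>N\<close> ends with the factor \<open>N + 1 - m\<close>, just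
  before the numerator of \<open>(N - m) gchoose (N - j)\<close> begins; together they form the
  weight at \<open>j\<close>, so \<open>m\<close> survives only in the weights.\<close>

lemma weighted_self_inverse:
  fixes m :: real and a :: "nat \<Rightarrow> 'a :: real_normed_field"
  assumes a: "(\<Sum>k = 0..N. of_real ((real N - m) gchoose k) * (- 1) ^ (N - k) * a (N - k)) = \<epsilon> * a N"
    and N: "N \<le> n"
  defines "u \<equiv> \<lambda>j. of_real (fact (n - j) * ((real n - m) gchoose (n - j))) * a j"
  shows "(\<Sum>j\<le>N. (- 1) ^ j * u j / fact (N - j)) = \<epsilon> * u N"
proof -
  have "\<epsilon> * u N = of_real (fact (n - N) * ((real n - m) gchoose (n - N))) * (\<epsilon> * a N)"
    by (simp add: u_def mult_ac)
  also have "\<epsilon> * a N = (\<Sum>k\<le>N. of_real ((real N - m) gchoose k) * (- 1) ^ (N - k) * a (N - k))"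
    using a by (simp add: atLeast0AtMost)
  also have "\<dots> = (\<Sum>j\<le>N. of_real ((real N - m) gchoose (N - j)) * (- 1) ^ j * a j)"
    by (rule sum.reindex_bij_witness[of _ "\<lambda>j. N - j" "\<lambda>k. N - k"]) auto
  also have "of_real (fact (n - N) * ((real n - m) gchoose (n - N))) * \<dots>
      = (\<Sum>j\<le>N. (- 1) ^ j * u j / fact (N - j))"
    unfolding sum_distrib_left
  proof (intro sum.cong refl)
    fix j assume "j \<in> {..N}"
    with N have "fact (n - N) * ((real n - m) gchoose (n - N)) * ((real N - m) gchoose (N - j))
        = fact (n - j) * ((real n - m) gchoose (n - j)) / fact (N - j)"
      using fact_gbinomial_mult_gbinomial[of "n - N" "n - j" "real n - m"]
      by (simp add: of_nat_diff)
    from arg_cong[OF this, of "of_real :: real \<Rightarrow> 'a"]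
    have "of_real (fact (n - N) * ((real n - m) gchoose (n - N))) * of_real ((real N - m) gchoose (N - j))
        = (of_real (fact (n - j) * ((real n - m) gchoose (n - j))) / fact (N - j) :: 'a)"
      by simp
    then show "of_real (fact (n - N) * ((real n - m) gchoose (n - N)))
          * (of_real ((real N - m) gchoose (N - j)) * (- 1) ^ j * a j)
        = (- 1) ^ j * u j / fact (N - j)"
      unfolding u_def mult.assoc[symmetric] by simp
  qed
  finally show ?thesis by simp
qed

theorem theorem2p6:
  fixes m p :: real and \<alpha> \<beta> :: int and a b :: "nat \<Rightarrow> 'a :: real_normed_field" and n :: nat
  assumes "\<And>n. (\<Sum>k = 0..n. of_real ((real n - m) gchoose k) * (- 1) ^ (n - k) * a (n - k))
                 = (- 1) powi \<alpha> * a n"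
    and "\<And>n. (\<Sum>k = 0..n. of_real ((real n - p) gchoose k) * (- 1) ^ (n - k) * b (n - k))
                 = (- 1) powi \<beta> * b n"
    and "odd (\<alpha> + \<beta> + int n)"
  shows "(\<Sum>k = 0..n. of_real (((real n - m) gchoose k) * ((real n - p) gchoose (n - k))
                             / real (n choose k)) * (- 1) ^ k * a (n - k) * b k) = 0"
proof -
  define u where "u = (\<lambda>j. of_real (fact (n - j) * ((real n - m) gchoose (n - j))) * a j)"
  define v where "v = (\<lambda>j. of_real (fact (n - j) * ((real n - p) gchoose (n - j))) * b j)"
  define T where "T = (\<Sum>k\<le>n. (- 1) ^ k * u (n - k) * v k)"
  have "(- 1) powi \<beta> * T = (- 1) ^ n * (- 1) powi \<alpha> * T"
    unfolding T_def
    by (rule alternating_convolution_symmetry)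
      (unfold u_def v_def, (rule weighted_self_inverse, rule assms, assumption)+)
  \<comment> \<open>Oddness of \<open>\<alpha> + \<beta> + n\<close> makes the two signs in front of
    \<open>T\<close> opposite.\<close>
  with assms(3) have "T = - T"
    by (cases "even \<alpha>"; cases "even \<beta>")
      (auto simp: power_int_minus_left minus_one_power_iff split: if_splits)
  then have "T = 0"
    by simp
  have "(\<Sum>k = 0..n. of_real (((real n - m) gchoose k) * ((real n - p) gchoose (n - k))
          / real (n choose k)) * (- 1) ^ k * a (n - k) * b k) = T / fact n"
    unfolding T_def sum_divide_distrib atLeast0AtMost
  proof (intro sum.cong refl)
    fix k assume "k \<in> {..n}"
    then show "of_real (((real n - m) gchoose k) * ((real n - p) gchoose (n - k))
          / real (n choose k)) * (- 1) ^ k * a (n - k) * b k = (- 1) ^ k * u (n - k) * v k / fact n"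
      \<comment> \<open>The weights contribute \<open>fact k * fact (n - k)\<close>, which is
        \<open>fact n / (n choose k)\<close>.\<close>
      by (simp add: u_def v_def binomial_fact field_simps)
  qed
  with \<open>T = 0\<close> show ?thesis
    by simp
qed

end
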